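(* Let $X=(V,E)$ be a finite graph realized as a truss in $\mathbb{R}^n$ by $p:V\to\mathbb{R}^n$, and let $\partial:C_1\mathcal{F}\to C_0\mathcal{F}$ be the boundary matrix of its force cosheaf $\mathcal{F}$, with homology $H_1\mathcal{F}=\ker\partial$ and $H_0\mathcal{F}=C_0\mathcal{F}/\operatorname{im}\partial$. Let $|V|$ and $|E|$ be the numbers of vertices and edges, $|S|$ the number of (independent) self-stresses and $|M|$ the number of (independent) linkage mechanisms of the truss. Then $$n|V|-|E|=\dim C_0\mathcal{F}-\dim C_1\mathcal{F}=\dim H_0\mathcal{F}-\dim H_1\mathcal{F}=\binom{n+1}{2}+|M|-|S|.$$ (This is the Maxwell Rule in dimension $n$; for $n=3$ it reads $3|V|-|E|=6+|M|-|S|$.)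
   Context: $X=(V,E)$ is a finite undirected graph, each edge connecting two distinct vertices, modelling a truss of axial members $E$ pinned at free-rotational joints $V$; $p:V\to\mathbb{R}^n$ assigns positions to the vertices so that the edges are embedded linearly, as straight segments. Force cosheaf: each vertex $v$ carries the vector space $\mathcal{F}_v=\mathbb{R}^n$ (loads at the joint) and each edge $e$ carries the vector space $\mathcal{F}_e=\mathbb{R}$ (stress along the member). For an edge $e$ joining $u$ and $v$, the cosheaf matrix $\mathcal{F}_e\to\mathcal{F}_u$ sends the basis vector to $p(u)-p(v)$, and $\mathcal{F}_e\to\mathcal{F}_v$ sends it to $p(v)-p(u)$. Put $C_0\mathcal{F}=\bigoplus_{v\in V}\mathcal{F}_v$ and $C_1\mathcal{F}=\bigoplus_{e\in E}\mathcal{F}_e$. The boundary (equilibrium) matrix $\partial:C_1\mathcal{F}\to C_0\mathcal{F}$ sends $s=(s_e)_{e\in E}$ to the net force at each vertex, $$(\partial s)_v=\sum_{e=uv\in E,\ e\ni v} s_e\,(p(v)-p(u)).$$ $H_1\mathcal{F}=\ker\partial$ consists of the self-stresses, i.e. the stress distributions with zero net force at every joint, and its dimension is the number $|S|$ of self-stresses. $H_0\mathcal{F}=C_0\mathcal{F}/\operatorname{im}\partial$ is interpreted as the space of constrained degrees of freedom of the vertices (infinitesimal motions under which edge lengths remain constant); it comprises the global translations, the global rotations, and the linkage mechanisms. The Euclidean group of translations and rotations in $\mathbb{R}^n$ has dimension $\binom{n+1}{2}=\tfrac12 n(n+1)$, and this is the number of degrees of freedom attributed to global translations and rotations; $|M|$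 is the number of the remaining degrees of freedom, the linkage mechanisms. *)

theory Defs
  imports "HOL-Analysis.Analysis" "HOL-Algebra.AbelCoset" "Jordan_Normal_Form.VS_Connect"
begin

text \<open>
  Real vector spaces whose carrier depends on a term (a graph, a placement) are
  represented by module records over \<^term>\<open>class_ring :: real ring\<close>. Since
  \<^typ>\<open>(real, 'c) module\<close> extends the ring record, the fields for multiplication and one
  have to be filled in, but they play no role.
\<close>

abbreviation vdim :: "(real, 'c, 'd) module_scheme \<Rightarrow> nat" where
  "vdim W \<equiv> vectorspace.dim class_ring W"

text \<open>Direct sum of copies of \<^typ>\<open>'a\<close>, one for each element of a finite index set.\<close>

definition power_space :: "'i set \<Rightarrow> (real, 'i \<Rightarrow> 'a::real_vector) module" where
  "power_space I = \<lparr>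
     carrier = I \<rightarrow>\<^sub>E UNIV,
     mult = (\<lambda>x y. \<lambda>i\<in>I. 0),
     one = (\<lambda>i\<in>I. 0),
     zero = (\<lambda>i\<in>I. 0),
     add = (\<lambda>x y. \<lambda>i\<in>I. x i + y i),
     smult = (\<lambda>r x. \<lambda>i\<in>I. r *\<^sub>R x i)\<rparr>"

text \<open>The quotient of \<open>W\<close> by a subspace with carrier \<open>N\<close>: its vectors are the cosets of \<open>N\<close>.\<close>

definition quotient_space :: "(real, 'c) module \<Rightarrow> 'c set \<Rightarrow> (real, 'c set) module" where
  "quotient_space W N = \<lparr>
     carrier = a_rcosets\<^bsub>W\<^esub> N,
     mult = (\<lambda>X Y. N),
     one = N,
     zero = N,
     add = set_add W,
     smult = (\<lambda>r X. \<Union>x\<in>X. N +>\<^bsub>W\<^esub> (r \<odot>\<^bsub>W\<^esub> x))\<rparr>"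

definition finite_graph :: "'v set \<Rightarrow> 'v set set \<Rightarrow> bool" where
  "finite_graph V E \<longleftrightarrow> finite V \<and> (\<forall>e\<in>E. e \<subseteq> V \<and> card e = 2)"

text \<open>The endpoint of \<open>e\<close> different from \<open>v\<close>, for a two-element set \<open>e\<close> containing \<open>v\<close>.\<close>

definition other_end :: "'v set \<Rightarrow> 'v \<Rightarrow> 'v" where
  "other_end e v = the_elem (e - {v})"

definition force_map :: "('v \<Rightarrow> real^'n) \<Rightarrow> 'v set \<Rightarrow> 'v \<Rightarrow> real \<Rightarrow> real^'n" where
  "force_map p e v s = s *\<^sub>R (p v - p (other_end e v))"

definition C0 :: "'v set \<Rightarrow> (real, 'v \<Rightarrow> real^'n) module" where
  "C0 V = power_space V"

definition C1 :: "'v set set \<Rightarrow> (real, 'v set \<Rightarrow> real) module" where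
  "C1 E = power_space E"

definition boundary ::
  "'v set \<Rightarrow> 'v set set \<Rightarrow> ('v \<Rightarrow> real^'n) \<Rightarrow> ('v set \<Rightarrow> real) \<Rightarrow> ('v \<Rightarrow> real^'n)" where
  "boundary V E p s = (\<lambda>v\<in>V. \<Sum>e | e \<in> E \<and> v \<in> e. force_map p e v (s e))"

definition H1 ::
  "'v set \<Rightarrow> 'v set set \<Rightarrow> ('v \<Rightarrow> real^'n) \<Rightarrow> (real, 'v set \<Rightarrow> real) module" where
  "H1 V E p = (C1 E)\<lparr>carrier :=
     mod_hom.ker (C1 E) (C0 V :: (real, 'v \<Rightarrow> real^'n) module) (boundary V E p)\<rparr>"

definition H0 ::
  "'v set \<Rightarrow> 'v set set \<Rightarrow> ('v \<Rightarrow> real^'n) \<Rightarrow> (real, ('v \<Rightarrow> real^'n) set) module" where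
  "H0 V E p = quotient_space (C0 V) (mod_hom.im (C1 E) (boundary V E p))"

definition num_self_stresses :: "'v set \<Rightarrow> 'v set set \<Rightarrow> ('v \<Rightarrow> real^'n) \<Rightarrow> nat" where
  "num_self_stresses V E p = vdim (H1 V E p)"

text \<open>
  The Lie algebra of the Euclidean group of translations and rotations: the pair \<open>(A, b)\<close>
  is the infinitesimal motion \<open>x \<mapsto> A *v x + b\<close> of the ambient space.
\<close>

definition euclidean_motions :: "((real^'n^'n) \<times> (real^'n)) set" where
  "euclidean_motions = {(A, b). transpose A = - A}"

text \<open>
  The degrees of freedom left over after those of the Euclidean group. The count is an integer:
  it is negative if the joints lie in an affine subspace so small that the Euclidean group
  acts with stabilizer on them and there are too few other degrees of freedom (one joint in
  the plane, for instance). When the Euclidean Lie algebra acts faithfully on the joints, the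
  count is the dimension of the infinitesimal motions modulo the global ones.
\<close>

definition num_mechanisms :: "'v set \<Rightarrow> 'v set set \<Rightarrow> ('v \<Rightarrow> real^'n) \<Rightarrow> int" where
  "num_mechanisms V E p =
     int (vdim (H0 V E p)) - int (dim (euclidean_motions :: ((real^'n^'n) \<times> (real^'n)) set))"

end

theory Submission
  imports Defs
begin

text \<open>
  The Maxwell rule is the Euler characteristic of the two-term complex
  \<open>\<partial> : C\<^sub>1 \<rightarrow> C\<^sub>0\<close>. Rank-nullity for \<open>\<partial>\<close> gives
  \<open>dim (im \<partial>) + dim H\<^sub>1 = dim C\<^sub>1\<close>, and rank-nullity for the projection
  \<open>C\<^sub>0 \<rightarrow> C\<^sub>0 / im \<partial>\<close> (\<open>dim_quotient_space\<close>) gives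
  \<open>dim H\<^sub>0 + dim (im \<partial>) = dim C\<^sub>0\<close>. Subtracting cancels the unknown rank of \<open>\<partial>\<close>,
  so the difference of the homology dimensions depends neither on the placement nor on which
  joints the members connect.

  The chain spaces are direct sums of copies of \<open>\<real>\<^sup>n\<close> and \<open>\<real>\<close>, whose dimensions come from the
  standard basis (\<open>dim_power_space\<close>). The number of mechanisms is \<open>dim H\<^sub>0\<close> less the dimension of
  the Euclidean Lie algebra, so the remaining geometric content is that this algebra has
  dimension \<open>n (n + 1) / 2\<close> (\<open>dim_euclidean_motions\<close>): \<open>n\<close> translations, and
  \<open>n (n - 1) / 2\<close> rotations, because a skew-symmetric matrix is freely determined by its entries
  above the diagonal.
\<close>

section \<open>Powers of a Euclidean space\<close>

lemma power_space_simps [simp]: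
  "carrier (power_space I) = I \<rightarrow>\<^sub>E UNIV"
  "zero (power_space I) = (\<lambda>i\<in>I. 0)"
  "add (power_space I) x y = (\<lambda>i\<in>I. x i + y i)"
  "smult (power_space I) r x = (\<lambda>i\<in>I. r *\<^sub>R x i)"
  by (simp_all add: power_space_def)

lemma vectorspace_power_space:
  "vectorspace class_ring (power_space I :: (real, 'i \<Rightarrow> 'a::real_vector) module)"
proof (rule vs_criteria[OF class_field])
  show "\<forall>v\<in>carrier (power_space I). \<exists>w\<in>carrier (power_space I).
      v \<oplus>\<^bsub>power_space I\<^esub> w = \<zero>\<^bsub>power_space I :: (real, 'i \<Rightarrow> 'a) module\<^esub>"
  proof
    fix v :: "'i \<Rightarrow> 'a"
    show "\<exists>w\<in>carrier (power_space I). v \<oplus>\<^bsub>power_space I\<^esub> w = \<zero>\<^bsub>power_space I\<^esub>"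
      by (rule bexI[of _ "\<lambda>i\<in>I. - v i"]) (auto simp: restrict_def)
  qed
qed (auto simp: restrict_def PiE_iff extensional_def algebra_simps fun_eq_iff)

text \<open>
  Evaluation at an index is additive. It turns linear combinations in the record-based
  vector space into ordinary sums, which the inner product of \<open>'a\<close> can take apart.
\<close>
lemma finsum_power_space:
  assumes "finite A" and "f \<in> A \<rightarrow> carrier (power_space I)" and "i \<in> I"
  shows "finsum (power_space I :: (real, 'i \<Rightarrow> 'a::real_vector) module) f A i = (\<Sum>a\<in>A. f a i)"
proof -
  interpret P: vectorspace class_ring "power_space I :: (real, 'i \<Rightarrow> 'a) module"
    by (rule vectorspace_power_space)
  from assms show ?thesis
  proof (induction A rule: finite_induct)
    case empty
    then show ?case by (simp add: P.finsum_empty del: power_space_simps(1))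
  next
    case (insert a A)
    then have "f \<in> A \<rightarrow> carrier (power_space I)" "f a \<in> carrier (power_space I)" by auto
    with insert show ?case
      by (subst P.M.finsum_insert) auto
  qed
qed

definition coordinate_vector :: "'i set \<Rightarrow> 'i \<Rightarrow> 'a::zero \<Rightarrow> ('i \<Rightarrow> 'a)" where
  "coordinate_vector I i b = (\<lambda>j\<in>I. if j = i then b else 0)"

lemma power_space_basis:
  fixes I :: "'i set"
  defines "B \<equiv> (\<lambda>(i, b::'a::euclidean_space). coordinate_vector I i b) ` (I \<times> Basis)"
  assumes "finite I"
  shows "finite B" and "card B = card I * DIM('a)"
    and "vectorspace.basis class_ring (power_space I :: (real, 'i \<Rightarrow> 'a) module) B"
proof -
  let ?P = "power_space I :: (real, 'i \<Rightarrow> 'a) module"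
  let ?e = "\<lambda>(i, b::'a). coordinate_vector I i b"
  interpret P: vectorspace class_ring ?P
    by (rule vectorspace_power_space)
  have inj: "inj_on ?e (I \<times> Basis)"
  proof (rule inj_onI, clarify)
    fix i j and b c :: 'a
    assume ij: "i \<in> I" "j \<in> I" and bc: "b \<in> Basis" "c \<in> Basis"
      and eq: "coordinate_vector I i b = coordinate_vector I j c"
    from fun_cong[OF eq, of i] ij have "b = (if i = j then c else 0)"
      by (simp add: coordinate_vector_def)
    with bc nonzero_Basis show "i = j \<and> b = c" by (auto split: if_splits)
  qed
  show fin: "finite B" unfolding B_def using assms by auto
  show "card B = card I * DIM('a)"
    unfolding B_def by (simp add: card_image[OF inj] card_cartesian_product)
  have BP: "B \<subseteq> carrier ?P" by (auto simp: B_def coordinate_vector_def)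
  have lincomb: "P.lincomb a B j = (\<Sum>b\<in>Basis. a (coordinate_vector I j b) *\<^sub>R b)"
    if "j \<in> I" for a j
  proof -
    have "P.lincomb a B j = (\<Sum>w\<in>B. a w *\<^sub>R w j)"
      unfolding P.lincomb_def using fin that by (subst finsum_power_space) auto
    also have "\<dots> = (\<Sum>(i, b)\<in>I \<times> Basis. a (coordinate_vector I i b) *\<^sub>R coordinate_vector I i b j)"
      unfolding B_def by (subst sum.reindex[OF inj]) (simp add: case_prod_unfold)
    also have "\<dots> = (\<Sum>i\<in>I. if i = j then \<Sum>b\<in>Basis. a (coordinate_vector I i b) *\<^sub>R b else 0)"
      unfolding sum.cartesian_product[symmetric]
      using that by (intro sum.cong) (auto simp: coordinate_vector_def)
    also have "\<dots> = (\<Sum>b\<in>Basis. a (coordinate_vector I j b) *\<^sub>R b)"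
      using that \<open>finite I\<close> by (simp add: sum.delta')
    finally show ?thesis .
  qed
  show "P.basis B"
    unfolding P.basis_def
  proof (intro conjI)
    show "P.lin_indpt B"
    proof (rule P.finite_lin_indpt2[OF fin BP])
      fix a assume 0: "P.lincomb a B = \<zero>\<^bsub>?P\<^esub>"
      have "a (coordinate_vector I i b) = 0" if "i \<in> I" "b \<in> Basis" for i b
      proof -
        have "(\<Sum>b\<in>Basis. a (coordinate_vector I i b) *\<^sub>R b) \<bullet> b = 0"
          using fun_cong[OF 0, of i] lincomb[of i a] that by simp
        with that show ?thesis by simp
      qed
      then show "\<forall>v\<in>B. a v = \<zero>\<^bsub>class_ring\<^esub>" by (auto simp: B_def)
    qed
    show "P.span B = carrier ?P"
    proof
      show "P.span B \<subseteq> carrier ?P" by (rule P.span_is_subset2[OF BP])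
      show "carrier ?P \<subseteq> P.span B"
      proof
        fix x assume x: "x \<in> carrier ?P"
        (* The vectors in B are orthonormal for the inner product of the direct sum,
           so the coefficients of x are its inner products with them. *)
        define a where "a w = (\<Sum>i\<in>I. x i \<bullet> w i)" for w :: "'i \<Rightarrow> 'a"
        have a: "a (coordinate_vector I j b) = x j \<bullet> b" if "j \<in> I" for j b
        proof -
          have "a (coordinate_vector I j b) = (\<Sum>i\<in>I. if i = j then x i \<bullet> b else 0)"
            unfolding a_def by (intro sum.cong) (auto simp: coordinate_vector_def)
          with that \<open>finite I\<close> show ?thesis by simp
        qed
        have aB: "a \<in> B \<rightarrow> carrier class_ring" by simp
        have "x = P.lincomb a B"
        proof (rule PiE_ext)
          show "x \<in> I \<rightarrow>\<^sub>E UNIV" using x by simp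
          show "P.lincomb a B \<in> I \<rightarrow>\<^sub>E UNIV" using P.lincomb_closed[OF BP aB] by simp
          show "x j = P.lincomb a B j" if "j \<in> I" for j
            using that by (simp add: lincomb a euclidean_representation)
        qed
        with P.finite_span[OF fin BP] aB show "x \<in> P.span B" by blast
      qed
    qed
  qed (rule BP)
qed

lemma dim_power_space:
  assumes "finite I"
  shows "vdim (power_space I :: (real, 'i \<Rightarrow> 'a::euclidean_space) module) = card I * DIM('a)"
    and "vectorspace.fin_dim class_ring (power_space I :: (real, 'i \<Rightarrow> 'a) module)"
proof -
  interpret P: vectorspace class_ring "power_space I :: (real, 'i \<Rightarrow> 'a) module"
    by (rule vectorspace_power_space)
  note B = power_space_basis[OF assms, where 'a = 'a]
  show "P.dim = card I * DIM('a)" using P.dim_basis[OF B(1,3)] B(2) by simp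
  show "P.fin_dim" using B unfolding P.fin_dim_def P.basis_def by blast
qed


section \<open>Quotient spaces\<close>

lemma quotient_space_simps [simp]:
  "carrier (quotient_space W N) = (\<lambda>x. N +>\<^bsub>W\<^esub> x) ` carrier W"
  "zero (quotient_space W N) = N"
  "add (quotient_space W N) = set_add W"
  "smult (quotient_space W N) r X = (\<Union>x\<in>X. N +>\<^bsub>W\<^esub> (r \<odot>\<^bsub>W\<^esub> x))"
  by (auto simp: quotient_space_def A_RCOSETS_def RCOSETS_def a_r_coset_def)

text \<open>Closure under negation comes from scalar multiplication by \<open>- 1\<close>.\<close>
lemma abelian_subgroup_if_subspace:
  assumes "VectorSpace.subspace K N W"
  shows "abelian_subgroup N W"
proof -
  interpret W: vectorspace K W using assms by (simp add: VectorSpace.subspace_def)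
  interpret N: submodule K N W using assms by (simp add: VectorSpace.subspace_def)
  have "\<ominus>\<^bsub>W\<^esub> x \<in> N" if "x \<in> N" for x
  proof -
    have "x \<in> carrier W" using that N.subset by blast
    then have "\<ominus>\<^bsub>W\<^esub> x = (\<ominus>\<^bsub>K\<^esub> \<one>\<^bsub>K\<^esub>) \<odot>\<^bsub>W\<^esub> x" by (rule W.smult_minus_1[symmetric])
    also have "\<dots> \<in> N" using that by (intro N.smult_closed) auto
    finally show ?thesis .
  qed
  then have "subgroup N (add_monoid W)"
    using N.subset N.m_closed N.zero_closed by (intro W.M.add.subgroupI) blast+
  then show ?thesis
    by (intro abelian_subgroupI3 additive_subgroup.intro W.M.abelian_group_axioms)
qed

text \<open>
  The scalar multiple of a coset is defined as a union over all its elements rather than by a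
  representative. All the cosets in that union coincide, since \<open>r \<odot> N \<subseteq> N\<close>.
\<close>
lemma smult_coset:
  assumes "VectorSpace.subspace class_ring N W" and x: "x \<in> carrier W"
  shows "r \<odot>\<^bsub>quotient_space W N\<^esub> (N +>\<^bsub>W\<^esub> x) = N +>\<^bsub>W\<^esub> (r \<odot>\<^bsub>W\<^esub> x)"
proof -
  interpret W: vectorspace class_ring W using assms by (simp add: VectorSpace.subspace_def)
  interpret N: submodule class_ring N W using assms by (simp add: VectorSpace.subspace_def)
  interpret A: abelian_subgroup N W by (rule abelian_subgroup_if_subspace[OF assms(1)])
  have coset_eq: "N +>\<^bsub>W\<^esub> (r \<odot>\<^bsub>W\<^esub> y) = N +>\<^bsub>W\<^esub> (r \<odot>\<^bsub>W\<^esub> x)" if y: "y \<in> N +>\<^bsub>W\<^esub> x" for y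
  proof -
    from y obtain n where n: "n \<in> N" and yn: "y = n \<oplus>\<^bsub>W\<^esub> x"
      unfolding a_r_coset_def' by blast
    have nW: "n \<in> carrier W" using n N.subset by blast
    have rx: "r \<odot>\<^bsub>W\<^esub> x \<in> carrier W" using x by (intro W.smult_closed) simp_all
    have rn: "r \<odot>\<^bsub>W\<^esub> n \<in> N" using n by (intro N.smult_closed) simp_all
    have "r \<odot>\<^bsub>W\<^esub> y = r \<odot>\<^bsub>W\<^esub> n \<oplus>\<^bsub>W\<^esub> r \<odot>\<^bsub>W\<^esub> x"
      unfolding yn using nW x by (intro W.smult_r_distr) simp_all
    also have "\<dots> \<in> N +>\<^bsub>W\<^esub> (r \<odot>\<^bsub>W\<^esub> x)"
      by (rule W.M.a_rcosI[OF rn N.subset rx])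
    finally show ?thesis
      by (rule A.a_repr_independence'[OF _ rx, symmetric])
  qed
  have "r \<odot>\<^bsub>quotient_space W N\<^esub> (N +>\<^bsub>W\<^esub> x) = (\<Union>y\<in>N +>\<^bsub>W\<^esub> x. N +>\<^bsub>W\<^esub> (r \<odot>\<^bsub>W\<^esub> x))"
    unfolding quotient_space_simps by (rule SUP_cong[OF refl coset_eq])
  also have "\<dots> = N +>\<^bsub>W\<^esub> (r \<odot>\<^bsub>W\<^esub> x)"
    using A.a_rcos_self[OF x] by blast
  finally show ?thesis .
qed

text \<open>
  Every element of the quotient is the image of a vector of \<open>W\<close>, and the operations are
  computed on representatives. So the axioms of a vector space pass from \<open>W\<close> to the quotient,
  and the projection is linear.
\<close>
lemma quotient_map_linear:
  assumes "VectorSpace.subspace class_ring N W"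
  shows "linear_map class_ring W (quotient_space W N) (\<lambda>x. N +>\<^bsub>W\<^esub> x)"
proof -
  interpret W: vectorspace class_ring W using assms by (simp add: VectorSpace.subspace_def)
  interpret N: submodule class_ring N W using assms by (simp add: VectorSpace.subspace_def)
  interpret A: abelian_subgroup N W by (rule abelian_subgroup_if_subspace[OF assms])
  let ?Q = "quotient_space W N"
  let ?q = "\<lambda>x. N +>\<^bsub>W\<^esub> x"
  note smult = smult_coset[OF assms]
  have Q: "carrier ?Q = ?q ` carrier W"
    by (rule quotient_space_simps(1))
  have add: "?q x \<oplus>\<^bsub>?Q\<^esub> ?q y = ?q (x \<oplus>\<^bsub>W\<^esub> y)" if "x \<in> carrier W" "y \<in> carrier W" for x y
    using A.a_rcos_sum[OF that] by simp
  have zero: "\<zero>\<^bsub>?Q\<^esub> = ?q \<zero>\<^bsub>W\<^esub>"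
    using N.subset by simp
  have closed: "?q x \<in> carrier ?Q" if "x \<in> carrier W" for x
    using that unfolding Q by blast
  have smult_W: "(a * b) \<odot>\<^bsub>W\<^esub> x = a \<odot>\<^bsub>W\<^esub> (b \<odot>\<^bsub>W\<^esub> x)" "1 \<odot>\<^bsub>W\<^esub> x = x"
    "(a + b) \<odot>\<^bsub>W\<^esub> x = a \<odot>\<^bsub>W\<^esub> x \<oplus>\<^bsub>W\<^esub> b \<odot>\<^bsub>W\<^esub> x" if "x \<in> carrier W" for a b x
    using W.smult_assoc1[OF _ _ that, of a b] W.smult_one[OF that] W.smult_l_distr[OF _ _ that, of a b]
    by (simp_all only: class_ring_simps UNIV_I simp_thms)
  have vs: "vectorspace class_ring ?Q"
  proof (rule vs_criteria[OF class_field])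
    show "\<forall>v\<in>carrier ?Q. \<exists>w\<in>carrier ?Q. v \<oplus>\<^bsub>?Q\<^esub> w = \<zero>\<^bsub>?Q\<^esub>"
    proof
      fix v assume "v \<in> carrier ?Q"
      then obtain x where x: "x \<in> carrier W" "v = ?q x" unfolding Q by blast
      then have "v \<oplus>\<^bsub>?Q\<^esub> ?q (\<ominus>\<^bsub>W\<^esub> x) = \<zero>\<^bsub>?Q\<^esub>"
        unfolding zero by (simp only: add W.M.a_inv_closed W.M.r_neg)
      then show "\<exists>w\<in>carrier ?Q. v \<oplus>\<^bsub>?Q\<^esub> w = \<zero>\<^bsub>?Q\<^esub>" using closed x(1) by blast
    qed
    show "\<forall>v w. v \<in> carrier ?Q \<and> w \<in> carrier ?Q \<longrightarrow> v \<oplus>\<^bsub>?Q\<^esub> w = w \<oplus>\<^bsub>?Q\<^esub> v"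
    proof (intro allI impI, elim conjE)
      fix v w assume "v \<in> carrier ?Q" "w \<in> carrier ?Q"
      then obtain x y where "x \<in> carrier W" "v = ?q x" "y \<in> carrier W" "w = ?q y"
        unfolding Q by blast
      then show "v \<oplus>\<^bsub>?Q\<^esub> w = w \<oplus>\<^bsub>?Q\<^esub> v"
        by (simp only: add W.M.a_comm[of x y])
    qed
  qed (unfold Q, auto simp: add smult zero W.M.a_assoc W.smult_r_distr smult_W
      simp del: quotient_space_simps)
  have "?q \<in> module_hom class_ring W ?Q"
    unfolding module_hom_def using closed add smult by (simp del: quotient_space_simps)
  with vs W.vectorspace_axioms show ?thesis
    by (intro linear_map.intro mod_hom.intro mod_hom_axioms.intro)
       (simp_all add: vectorspace_def)
qed

text \<open>Rank-nullity for the projection, which is surjective with kernel \<open>N\<close>.\<close>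
lemma dim_quotient_space:
  assumes "VectorSpace.subspace class_ring N W" and "vectorspace.fin_dim class_ring W"
  shows "vdim (quotient_space W N) + vdim (W\<lparr>carrier := N\<rparr>) = vdim W"
proof -
  let ?Q = "quotient_space W N"
  interpret A: abelian_subgroup N W by (rule abelian_subgroup_if_subspace[OF assms(1)])
  interpret q: linear_map class_ring W ?Q "\<lambda>x. N +>\<^bsub>W\<^esub> x"
    by (rule quotient_map_linear[OF assms(1)])
  have imT: "q.imT = carrier ?Q"
    unfolding q.im_def quotient_space_simps(1) ..
  have im: "?Q\<lparr>carrier := q.imT\<rparr> = ?Q"
    unfolding imT by (simp del: quotient_space_simps)
  have coset: "N +>\<^bsub>W\<^esub> x = N \<longleftrightarrow> x \<in> N" if "x \<in> carrier W" for x
    using A.a_rcos_self[OF that] A.a_rcos_const[of x] by metis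
  have "q.kerT = {x \<in> carrier W. N +>\<^bsub>W\<^esub> x = N}"
    unfolding q.ker_def quotient_space_simps(2) ..
  also have "\<dots> = {x \<in> carrier W. x \<in> N}"
    by (rule Collect_cong) (rule conj_cong[OF refl coset])
  also have "\<dots> = N" using A.a_subset by blast
  finally have ker: "q.kerT = N" .
  show ?thesis by (rule q.rank_nullity[OF assms(2), unfolded im ker])
qed


section \<open>The Euclidean Lie algebra\<close>

(* The index type of a matrix here is a finite type. With a second meaning of the same infix,
   iterated indexing would parse ambiguously. *)
no_notation vec_index (infixl \<open>$\<close> 100)

text \<open>
  The positions of a square matrix strictly above the diagonal. An arbitrary finite index type
  carries no order, so one is borrowed from the natural numbers through an injection \<open>f\<close>.
\<close>
lemma card_less_pairs:
  fixes f :: "'n::finite \<Rightarrow> nat"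
  assumes "inj f"
  shows "2 * card {(i, j). f i < f j} + CARD('n) = CARD('n) * CARD('n)"
proof -
  let ?L = "{(i, j). f i < f j}" and ?G = "{(i, j). f j < f i}" and ?D = "{(i, j). f i = f j}"
  have "bij_betw prod.swap ?L ?G"
    by (rule bij_betwI[where g = prod.swap]) auto
  then have G: "card ?G = card ?L" by (rule bij_betw_same_card[symmetric])
  have "?D = range (\<lambda>i. (i, i))" by (auto simp: inj_eq[OF assms])
  moreover have "card (range (\<lambda>i::'n. (i, i))) = CARD('n)"
    by (intro card_image) (simp add: inj_on_def)
  ultimately have D: "card ?D = CARD('n)" by (simp only:)
  have "CARD('n \<times> 'n) = card (?L \<union> (?G \<union> ?D))"
    by (rule arg_cong[of _ _ card]) auto
  also have "\<dots> = card ?L + card (?G \<union> ?D)"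
    by (rule card_Un_disjoint[OF finite finite]) auto
  also have "card (?G \<union> ?D) = card ?G + card ?D"
    by (rule card_Un_disjoint[OF finite finite]) auto
  finally show ?thesis unfolding G D by (simp only: card_prod mult_2 add_ac)
qed

text \<open>
  The map \<open>A \<mapsto> A - A\<^sup>T\<close> sends the strictly upper triangular matrices isomorphically onto the
  skew-symmetric ones, and the former are a coordinate subspace. Stating twice the dimension
  avoids the truncated subtraction in \<open>n (n - 1) / 2\<close>.
\<close>
lemma dim_skew_symmetric:
  "2 * dim {A :: real^'n^'n. transpose A = - A} + CARD('n) = CARD('n) * CARD('n)"
proof -
  obtain f :: "'n \<Rightarrow> nat" where f: "inj f"
    using finite_imp_inj_to_nat_seg[of "UNIV :: 'n set"] by auto
  define d :: "(real^'n^'n) set" where "d = (\<lambda>(i, j). axis i (axis j 1)) ` {(i, j). f i < f j}"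
  define U :: "(real^'n^'n) set" where "U = {A. \<forall>i j. \<not> f i < f j \<longrightarrow> A $ i $ j = 0}"
  define T :: "real^'n^'n \<Rightarrow> real^'n^'n" where "T A = A - transpose A" for A
  have axis: "axis i (axis j (1::real)) = axis k (axis l 1) \<longleftrightarrow> i = k \<and> j = l" for i j k l :: 'n
    by (auto simp: axis_eq_axis)
  have dB: "d \<subseteq> Basis" by (auto simp: d_def Basis_vec_def)
  have in_d: "axis i (axis j 1) \<in> d \<longleftrightarrow> f i < f j" for i j
    by (auto simp: d_def image_iff axis)
  have "U = {A. \<forall>b\<in>Basis. b \<notin> d \<longrightarrow> A \<bullet> b = 0}"
    by (simp add: U_def Basis_vec_def in_d inner_axis)
  then have "dim U = card d" using dim_substandard[OF dB] by simp
  also have "\<dots> = card {(i, j). f i < f j}"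
    unfolding d_def by (intro card_image) (auto simp: inj_on_def axis)
  finally have dimU: "dim U = card {(i, j). f i < f j}" .
  have "linear T"
    by (rule linearI) (simp_all add: T_def Finite_Cartesian_Product.vec_eq_iff transpose_def right_diff_distrib)
  moreover have "real_vector.subspace U" by (auto simp: real_vector.subspace_def U_def)
  moreover have "inj_on T U"
  proof (rule inj_onI)
    fix A B assume A: "A \<in> U" and B: "B \<in> U" and eq: "T A = T B"
    show "A = B"
    proof (simp add: Finite_Cartesian_Product.vec_eq_iff, intro allI)
      fix i j
      have "A $ i $ j - A $ j $ i = B $ i $ j - B $ j $ i"
        using eq by (simp add: T_def Finite_Cartesian_Product.vec_eq_iff transpose_def)
      then show "A $ i $ j = B $ i $ j"
        using A B by (cases "f i < f j") (auto simp: U_def)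
    qed
  qed
  ultimately have "dim (T ` U) = dim U"
    by (intro dim_image_eq) (simp_all only: real_vector.span_eq_iff[THEN iffD2])
  also have "T ` U = {A. transpose A = - A}"
  proof (intro equalityI subsetI)
    fix S assume "S \<in> {A :: real^'n^'n. transpose A = - A}"
    then have skew: "transpose S = - S" by simp
    have S: "S $ j $ i = - S $ i $ j" for i j
    proof -
      have "S $ j $ i = transpose S $ i $ j" by (simp add: transpose_def)
      also have "\<dots> = (- S) $ i $ j" by (simp only: skew)
      finally show ?thesis by simp
    qed
    define A where "A = (\<chi> i j. if f i < f j then S $ i $ j else 0)"
    have "S $ i $ j = T A $ i $ j" for i j
    proof -
      have TA: "T A $ i $ j = A $ i $ j - A $ j $ i" by (simp add: T_def transpose_def)
      consider "f i < f j" | "f j < f i" | "i = j" using injD[OF f, of i j] by linarith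
      then show ?thesis
      proof cases
        case 1
        then show ?thesis unfolding TA by (simp add: A_def)
      next
        case 2
        then show ?thesis unfolding TA using S[of i j] by (simp add: A_def)
      next
        case 3
        then show ?thesis unfolding TA using S[of i i] by simp
      qed
    qed
    then have "S = T A" by (simp add: Finite_Cartesian_Product.vec_eq_iff)
    moreover have "A \<in> U" by (simp add: U_def A_def)
    ultimately show "S \<in> T ` U" by blast
  next
    have "transpose (T A) = - T A" for A
      by (simp add: T_def Finite_Cartesian_Product.vec_eq_iff transpose_def)
    then show "S \<in> {A. transpose A = - A}" if "S \<in> T ` U" for S using that by blast
  qed
  finally show ?thesis using card_less_pairs[OF f] dimU by simp
qed

lemma dim_euclidean_motions:
  "dim (euclidean_motions :: ((real^'n^'n) \<times> (real^'n)) set) = (CARD('n) + 1) choose 2"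
proof -
  have "real_vector.subspace {A :: real^'n^'n. transpose A = - A}"
  proof -
    have "transpose 0 = (0 :: real^'n^'n)"
      and "transpose (A + B) = transpose A + transpose B"
      and "transpose (c *\<^sub>R A) = c *\<^sub>R transpose A" for A B :: "real^'n^'n" and c
      by (simp_all add: transpose_def Finite_Cartesian_Product.vec_eq_iff)
    then show ?thesis by (simp add: real_vector.subspace_def)
  qed
  then have "dim ({A :: real^'n^'n. transpose A = - A} \<times> (UNIV :: (real^'n) set)) =
      dim {A :: real^'n^'n. transpose A = - A} + CARD('n)"
    by (subst dim_Times) auto
  moreover have "euclidean_motions = {A :: real^'n^'n. transpose A = - A} \<times> (UNIV :: (real^'n) set)"
    by (auto simp: euclidean_motions_def)
  ultimately have "2 * dim (euclidean_motions :: ((real^'n^'n) \<times> (real^'n)) set) =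
      CARD('n) * CARD('n) + CARD('n)"
    using dim_skew_symmetric[where 'n = 'n] by simp
  then show ?thesis by (simp add: choose_two algebra_simps)
qed


section \<open>The force cosheaf\<close>

lemma boundary_linear_map:
  "linear_map class_ring (C1 E) (C0 V :: (real, 'v \<Rightarrow> real^'n) module) (boundary V E p)"
proof -
  have "boundary V E p \<in> module_hom class_ring (C1 E) (C0 V :: (real, 'v \<Rightarrow> real^'n) module)"
    unfolding module_hom_def C0_def C1_def
    by (auto simp: boundary_def force_map_def fun_eq_iff scaleR_sum_right
        sum.distrib[symmetric] algebra_simps intro!: sum.cong)
  then show ?thesis
    using vectorspace_power_space[of V, where 'a = "real^'n"] vectorspace_power_space[of E, where 'a = real]
    unfolding C0_def C1_def
    by (intro linear_map.intro mod_hom.intro mod_hom_axioms.intro) (simp_all add: vectorspace_def)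
qed

theorem mainTheorem1:
  fixes V :: "'v set" and E :: "'v set set" and p :: "'v \<Rightarrow> real^'n"
  assumes "finite_graph V E"
  shows "int CARD('n) * int (card V) - int (card E)
           = int (vdim (C0 V :: (real, 'v \<Rightarrow> real^'n) module)) - int (vdim (C1 E))
       \<and> int (vdim (C0 V :: (real, 'v \<Rightarrow> real^'n) module)) - int (vdim (C1 E))
           = int (vdim (H0 V E p)) - int (vdim (H1 V E p))
       \<and> int (vdim (H0 V E p)) - int (vdim (H1 V E p))
           = int ((CARD('n) + 1) choose 2) + num_mechanisms V E p
               - int (num_self_stresses V E p)"
proof -
  let ?C0 = "C0 V :: (real, 'v \<Rightarrow> real^'n) module"
  have V: "finite V" and E: "finite E"
    using assms finite_subset[of E "Pow V"] by (auto simp: finite_graph_def)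
  interpret bd: linear_map class_ring "C1 E" ?C0 "boundary V E p"
    by (rule boundary_linear_map)
  have C0: "vdim ?C0 = CARD('n) * card V" and fin0: "vectorspace.fin_dim class_ring ?C0"
    using dim_power_space[OF V, where 'a = "real^'n"] by (simp_all add: C0_def)
  have C1: "vdim (C1 E) = card E" and fin1: "vectorspace.fin_dim class_ring (C1 E)"
    using dim_power_space[OF E, where 'a = real] by (simp_all add: C1_def)
  have "vdim (?C0\<lparr>carrier := bd.imT\<rparr>) + vdim (H1 V E p) = vdim (C1 E)"
    unfolding H1_def by (rule bd.rank_nullity[OF fin1])
  moreover have "vdim (H0 V E p) + vdim (?C0\<lparr>carrier := bd.imT\<rparr>) = vdim ?C0"
    unfolding H0_def by (rule dim_quotient_space[OF bd.imT_is_subspace fin0])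
  ultimately have euler: "int (vdim ?C0) - int (vdim (C1 E)) = int (vdim (H0 V E p)) - int (vdim (H1 V E p))"
    by linarith
  show ?thesis
    using C0 C1 euler
    unfolding num_mechanisms_def num_self_stresses_def dim_euclidean_motions
    by simp
qed

end
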